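(* Let $k\geq 1$ and $1\leq d\leq k$. For $n\geq 0$ let $P_n(t)=\sum_w t^{\mathrm{bigtiles}(w)}$, where $w=a_1\cdots a_n$ ranges over all words of length $n$ over $\{1,\dotsc,d,\infty\}$ such that $a_n=\infty$ (for $n\geq1$) and $a_i\neq\infty$ implies $a_{i+1}\geq a_i+k$ (with $\infty$ larger than every integer), and $\mathrm{bigtiles}(w)$ is the number of letters different from $\infty$. (Equivalently, $P_n(t)=\sum_T t^{\#\text{rectangles in }T}$ over all tilings $T$ of the board with $k+d-1$ rows and $n$ columns by unit squares and $k\times 2$ rectangles.) Then \[ \sum_{n\geq0}P_n(t)x^n=\frac{1}{1-(x+d\,t\,x^2)}, \] so that $P_n(t)=P_{n-1}(t)+d\,t\,P_{n-2}(t)$ for $n\geq 2$, with $P_0=P_1=1$; moreover every $P_n(t)$ has only real zeros. *)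

theory Defs
  imports
    "HOL-Computational_Algebra.Computational_Algebra"
    "HOL-Library.Extended_Nat"
    "HOL-Library.Disjoint_Sets"
    Complex_Main
begin

definition tiling_words :: "nat \<Rightarrow> nat \<Rightarrow> nat \<Rightarrow> enat list set" where
  "tiling_words k d n =
    {w. length w = n \<and> set w \<subseteq> insert \<infinity> (enat ` {1..d}) \<and>
        (n \<ge> 1 \<longrightarrow> last w = \<infinity>) \<and>
        (\<forall>i. Suc i < n \<longrightarrow> w ! i \<noteq> \<infinity> \<longrightarrow> w ! Suc i \<ge> w ! i + enat k)}"

definition bigtiles :: "enat list \<Rightarrow> nat" where
  "bigtiles w = length (filter (\<lambda>a. a \<noteq> \<infinity>) w)"

definition tiling_poly :: "nat \<Rightarrow> nat \<Rightarrow> nat \<Rightarrow> real poly" where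
  "tiling_poly k d n = (\<Sum>w\<in>tiling_words k d n. monom 1 (bigtiles w))"

text \<open>A cell is a pair (row, column); a tile is a set of cells. Rectangles are not rotated:
  they always occupy \<open>k\<close> consecutive rows and two consecutive columns.\<close>

definition board :: "nat \<Rightarrow> nat \<Rightarrow> (nat \<times> nat) set" where
  "board r n = {1..r} \<times> {1..n}"

definition unit_square :: "(nat \<times> nat) set \<Rightarrow> bool" where
  "unit_square R \<longleftrightarrow> (\<exists>i j. R = {(i, j)})"

definition big_rectangle :: "nat \<Rightarrow> (nat \<times> nat) set \<Rightarrow> bool" where
  "big_rectangle k R \<longleftrightarrow> (\<exists>i j. R = {i..<i + k} \<times> {j, Suc j})"

definition tilings :: "nat \<Rightarrow> nat \<Rightarrow> nat \<Rightarrow> (nat \<times> nat) set set set" where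
  "tilings k d n =
    {T. partition_on (board (k + d - 1) n) T \<and> (\<forall>R\<in>T. unit_square R \<or> big_rectangle k R)}"

definition rectangle_count :: "nat \<Rightarrow> (nat \<times> nat) set set \<Rightarrow> nat" where
  "rectangle_count k T = card {R \<in> T. big_rectangle k R}"

definition only_real_zeros :: "real poly \<Rightarrow> bool" where
  "only_real_zeros p \<longleftrightarrow> (\<forall>z::complex. poly (map_poly complex_of_real p) z = 0 \<longrightarrow> z \<in> \<real>)"

lemma finite_tiling_words: "finite (tiling_words k d n)"
proof (rule finite_subset)
  show "tiling_words k d n \<subseteq> {w. set w \<subseteq> insert \<infinity> (enat ` {1..d}) \<and> length w = n}"
    by (auto simp: tiling_words_def)
qed (simp add: finite_lists_length_eq)

lemma finite_tilings: "finite (tilings k d n)"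
proof (rule finite_subset)
  show "tilings k d n \<subseteq> {T. partition_on (board (k + d - 1) n) T}"
    by (auto simp: tilings_def)
qed (simp add: board_def finitely_many_partition_on)

end

theory Submission imports Defs begin

text \<open>Since \<open>d \<le> k\<close>, every big rectangle on the board meets row \<open>k\<close>, so no two of them share a
  column; on the side of words, every finite letter is followed by \<open>\<infinity>\<close>. Reading off the top row of
  the rectangle starting in each column therefore matches tilings with words, and splitting off
  the first one or two letters of a word gives the recurrence.

  For the zeros, let \<open>\<alpha> + \<beta> = 1\<close> and \<open>\<alpha> \<beta> = - d z\<close>. The recurrence yields
  \<open>(\<alpha> - \<beta>) P\<^sub>n(z) = \<alpha>^(n+1) - \<beta>^(n+1)\<close>, so \<open>P\<^sub>n(z) = 0\<close> forces \<open>\<bar>\<alpha>\<bar> = \<bar>\<beta>\<bar> = \<bar>1 - \<alpha>\<bar>\<close>.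
  Hence \<open>Re \<alpha> = 1/2\<close>, so \<open>\<beta>\<close> is the conjugate of \<open>\<alpha>\<close> and \<open>- d z = \<bar>\<alpha>\<bar>\<^sup>2\<close> is real.\<close>

section \<open>Words\<close>

lemma tiling_words_0: "tiling_words k d 0 = {[]}"
  by (auto simp: tiling_words_def)

lemma tiling_words_1: "tiling_words k d 1 = {[\<infinity>]}"
  by (auto simp: tiling_words_def length_Suc_conv)

text \<open>A finite letter cannot be last, since the last letter is \<open>\<infinity>\<close>. Its
  successor is at least \<open>a + k\<close>, which exceeds \<open>d\<close> because
  \<open>a\<close> is positive and \<open>d \<le> k\<close>, so only \<open>\<infinity>\<close>
  remains.\<close>

lemma tiling_words_letter:
  assumes w: "w \<in> tiling_words k d n" and dk: "d \<le> k" and i: "i < n" and a: "w ! i = enat a"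
  shows "1 \<le> a" "a \<le> d" "Suc i < n" "w ! Suc i = \<infinity>"
proof -
  from w have len: "length w = n" and set: "set w \<subseteq> insert \<infinity> (enat ` {1..d})"
    and last: "n \<ge> 1 \<Longrightarrow> last w = \<infinity>"
    and step: "\<And>i. Suc i < n \<Longrightarrow> w ! i \<noteq> \<infinity> \<Longrightarrow> w ! Suc i \<ge> w ! i + enat k"
    by (auto simp: tiling_words_def)
  have letter: "w ! j = \<infinity> \<or> w ! j \<in> enat ` {1..d}" if "j < n" for j
    using set nth_mem[of j w] that len by blast
  from letter[OF i] a show a1: "1 \<le> a" "a \<le> d"
    by auto
  have "i \<noteq> n - 1"
    using last i a len by (cases "w = []") (auto simp: last_conv_nth)
  with i show *: "Suc i < n" by simp
  from step[OF *] a have "w ! Suc i \<ge> enat (a + k)" by simp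
  with letter[OF *] a1 dk show "w ! Suc i = \<infinity>" by auto
qed

text \<open>A leading \<open>\<infinity>\<close> puts no condition on the letter after it. If
  \<open>w\<close> is empty, it is itself the required last letter.\<close>

lemma Cons_infinity_in_tiling_words_iff:
  "\<infinity> # w \<in> tiling_words k d (Suc n) \<longleftrightarrow> w \<in> tiling_words k d n"
proof -
  have "(\<forall>i. Suc i < Suc n \<longrightarrow> (\<infinity> # w) ! i \<noteq> \<infinity> \<longrightarrow> (\<infinity> # w) ! Suc i \<ge> (\<infinity> # w) ! i + enat k) \<longleftrightarrow>
        (\<forall>i. Suc i < n \<longrightarrow> w ! i \<noteq> \<infinity> \<longrightarrow> w ! Suc i \<ge> w ! i + enat k)"
    by (auto simp: nth_Cons split: nat.splits)
  then show ?thesis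
    by (cases w) (auto simp: tiling_words_def)
qed

lemma Cons_enat_in_tiling_words:
  assumes "w \<in> tiling_words k d n" and "a \<in> {1..d}"
  shows "enat a # \<infinity> # w \<in> tiling_words k d (Suc (Suc n))"
proof -
  have "\<infinity> # w \<in> tiling_words k d (Suc n)"
    using assms by (simp add: Cons_infinity_in_tiling_words_iff)
  then show ?thesis
    using assms(2) by (auto simp: tiling_words_def nth_Cons split: nat.splits)
qed

lemma tiling_words_tl:
  assumes "a # w \<in> tiling_words k d (Suc (Suc n))"
  shows "w \<in> tiling_words k d (Suc n)"
  using assms by (fastforce simp: tiling_words_def split: if_splits)

text \<open>Split by the first letter: after \<open>\<infinity>\<close> any shorter word may follow;
  a finite letter forces \<open>\<infinity>\<close> next, and then again any word may
  follow.\<close>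

lemma tiling_words_Suc_Suc:
  assumes "d \<le> k"
  shows "tiling_words k d (Suc (Suc n)) =
    Cons \<infinity> ` tiling_words k d (Suc n) \<union>
    (\<lambda>(a, w). enat a # \<infinity> # w) ` ({1..d} \<times> tiling_words k d n)"
    (is "?L = ?R")
proof (intro Set.set_eqI iffI)
  fix w assume w: "w \<in> ?L"
  then obtain x y v where v: "w = x # y # v"
    by (auto simp: tiling_words_def length_Suc_conv)
  show "w \<in> ?R"
  proof (cases x)
    case infinity
    with w v show ?thesis by (auto simp: Cons_infinity_in_tiling_words_iff)
  next
    case (enat a)
    with tiling_words_letter[OF w assms, of 0 a] v
    have a: "1 \<le> a" "a \<le> d" "y = \<infinity>" by auto
    with w v have "v \<in> tiling_words k d n"
      using Cons_infinity_in_tiling_words_iff tiling_words_tl by blast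
    with a v enat show ?thesis by force
  qed
next
  fix w assume "w \<in> ?R"
  then show "w \<in> ?L"
    by (auto simp: Cons_infinity_in_tiling_words_iff intro: Cons_enat_in_tiling_words)
qed

lemma tiling_poly_0: "tiling_poly k d 0 = 1"
  by (simp add: tiling_poly_def tiling_words_0 bigtiles_def)

lemma tiling_poly_1: "tiling_poly k d 1 = 1"
  by (simp only: tiling_poly_def tiling_words_1) (simp add: bigtiles_def)

lemma tiling_poly_Suc_Suc:
  assumes "d \<le> k"
  shows "tiling_poly k d (Suc (Suc n)) =
    tiling_poly k d (Suc n) + of_nat d * [:0, 1:] * tiling_poly k d n"
proof -
  let ?f = "\<lambda>(a, w). enat a # \<infinity> # w"
  have inj: "inj_on ?f ({1..d} \<times> tiling_words k d n)"
    by (auto simp: inj_on_def)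
  have "tiling_poly k d (Suc (Suc n)) =
      (\<Sum>w\<in>Cons \<infinity> ` tiling_words k d (Suc n). monom 1 (bigtiles w)) +
      (\<Sum>w\<in>?f ` ({1..d} \<times> tiling_words k d n). monom 1 (bigtiles w))"
    unfolding tiling_poly_def tiling_words_Suc_Suc[OF assms]
    by (rule sum.union_disjoint) (auto simp: finite_tiling_words)
  also have "(\<Sum>w\<in>Cons \<infinity> ` tiling_words k d (Suc n). monom 1 (bigtiles w)) =
      tiling_poly k d (Suc n)"
    by (simp add: sum.reindex tiling_poly_def bigtiles_def)
  \<comment> \<open>The finite first letter contributes one factor \<open>[:0, 1:]\<close>, whatever
    its value; summing over the values then gives the factor \<open>d\<close>.\<close>
  also have "(\<Sum>w\<in>?f ` ({1..d} \<times> tiling_words k d n). monom (1::real) (bigtiles w)) =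
      (\<Sum>(a, w)\<in>{1..d} \<times> tiling_words k d n. [:0, 1:] * monom 1 (bigtiles w))"
    by (subst sum.reindex[OF inj]) (simp add: bigtiles_def monom_Suc case_prod_unfold)
  also have "\<dots> = of_nat d * [:0, 1:] * tiling_poly k d n"
    by (simp add: sum.cartesian_product[symmetric] tiling_poly_def sum_distrib_left mult.assoc)
  finally show ?thesis .
qed

section \<open>Generating function\<close>

text \<open>The value at 1 is what the recurrence gives from p(-1) = 0 and p(0) = 1, so multiplying
  the series by the denominator leaves only the constant term 1.\<close>

lemma fps_linear_recurrence_2:
  fixes p :: "nat \<Rightarrow> 'a::field"
  assumes "p 0 = 1" "p 1 = a" "\<And>n. p (Suc (Suc n)) = a * p (Suc n) + b * p n"
  shows "Abs_fps p = 1 / (1 - (fps_const a * fps_X + fps_const b * fps_X ^ 2))"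
proof -
  let ?D = "1 - (fps_const a * fps_X + fps_const b * fps_X ^ 2)"
  have "fps_nth (Abs_fps p * ?D) n = fps_nth 1 n" for n
  proof -
    have "Abs_fps p * ?D = Abs_fps p - fps_const a * (fps_X * Abs_fps p)
        - fps_const b * (fps_X * (fps_X * Abs_fps p))"
      by (simp add: algebra_simps power2_eq_square)
    then show ?thesis
      using assms by (cases n rule: nat.exhaust; cases "n - 1") auto
  qed
  then have eq: "Abs_fps p * ?D = 1"
    by (simp add: fps_eq_iff)
  then have "?D \<noteq> 0"
    by (metis mult_zero_right zero_neq_one)
  then show ?thesis
    using nonzero_mult_div_cancel_right[of ?D "Abs_fps p"] eq by simp
qed

section \<open>Real zeros\<close>

lemma only_real_zeros_linear_recurrence:
  fixes p :: "nat \<Rightarrow> real poly" and c :: nat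
  assumes p: "p 0 = 1" "p 1 = 1" "\<And>n. p (Suc (Suc n)) = p (Suc n) + of_nat c * [:0, 1:] * p n"
    and c: "c > 0"
  shows "only_real_zeros (p n)"
  unfolding only_real_zeros_def
proof (intro allI impI)
  fix z :: complex
  assume zero: "poly (map_poly complex_of_real (p n)) z = 0"
  define q where "q n = poly (map_poly complex_of_real (p n)) z" for n
  have rec: "q (Suc (Suc n)) = q (Suc n) + of_nat c * z * q n" for n
  proof -
    have "map_poly complex_of_real (p (Suc (Suc n))) =
        map_poly complex_of_real (p (Suc n)) +
        smult (of_nat c) (pCons 0 (map_poly complex_of_real (p n)))"
      by (rule poly_eqI)
         (auto simp: p coeff_map_poly coeff_pCons of_nat_poly split: nat.splits)
    then show ?thesis by (simp add: q_def)
  qed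
  \<comment> \<open>\<open>\<alpha>\<close> and \<open>\<beta>\<close> are the roots of X^2 - X - c
    z, the characteristic polynomial of the recurrence.\<close>
  define \<alpha> where "\<alpha> = (1 + csqrt (1 + 4 * (of_nat c * z))) / 2"
  define \<beta> where "\<beta> = 1 - \<alpha>"
  have prod: "of_nat c * z = - (\<alpha> * \<beta>)"
  proof -
    have "(csqrt (1 + 4 * (of_nat c * z)))\<^sup>2 = 1 + 4 * (of_nat c * z)" by simp
    then show ?thesis
      unfolding \<alpha>_def \<beta>_def by (simp add: field_simps power2_eq_square)
  qed
  \<comment> \<open>This is the Binet formula without division, so the double root \<alpha> =
    \<beta> needs no separate case. Two consecutive indices are carried along because the recurrence
    has order two.\<close>
  have "(\<alpha> - \<beta>) * q n = \<alpha> ^ Suc n - \<beta> ^ Suc n \<and>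
        (\<alpha> - \<beta>) * q (Suc n) = \<alpha> ^ Suc (Suc n) - \<beta> ^ Suc (Suc n)" for n
  proof (induction n)
    case 0
    then show ?case
      using p(1,2) by (simp add: q_def \<beta>_def algebra_simps)
  next
    case (Suc n)
    have "(\<alpha> - \<beta>) * q (Suc (Suc n)) =
        (\<alpha> - \<beta>) * q (Suc n) - \<alpha> * \<beta> * ((\<alpha> - \<beta>) * q n)"
      by (simp only: rec prod) (simp add: algebra_simps)
    also have "\<dots> = (\<alpha> + \<beta>) * (\<alpha> ^ Suc (Suc n) - \<beta> ^ Suc (Suc n))
        - \<alpha> * \<beta> * (\<alpha> ^ Suc n - \<beta> ^ Suc n)"
      using Suc by (simp add: \<beta>_def)
    also have "\<dots> = \<alpha> ^ Suc (Suc (Suc n)) - \<beta> ^ Suc (Suc (Suc n))"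
      by (simp add: algebra_simps)
    finally show ?case using Suc by simp
  qed
  then have "\<alpha> ^ Suc n = \<beta> ^ Suc n"
    using zero unfolding q_def by (metis mult_zero_right right_minus_eq)
  then have "norm \<alpha> ^ Suc n = norm \<beta> ^ Suc n"
    by (metis norm_power)
  \<comment> \<open>The exponent \<open>Suc n\<close> is positive, so equal powers of nonnegative
    reals have equal bases.\<close>
  then have "norm \<alpha> = norm \<beta>"
    by (rule power_inject_base) auto
  then have "(Re \<alpha>)\<^sup>2 + (Im \<alpha>)\<^sup>2 = (1 - Re \<alpha>)\<^sup>2 + (Im \<alpha>)\<^sup>2"
    by (simp add: cmod_def \<beta>_def)
  then have "Re \<alpha> = 1 / 2"
    by (simp add: power2_eq_square algebra_simps)
  then have "Im (\<alpha> * \<beta>) = 0"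
    by (simp add: \<beta>_def)
  then have "Im (of_nat c * z) = 0"
    using prod by simp
  then show "z \<in> \<real>"
    using c by (simp add: complex_is_Real_iff)
qed

section \<open>Tilings\<close>

text \<open>Makes the witnesses of \<open>big_rectangle\<close> explicit: \<open>a\<close> is the
  top row and \<open>j\<close> the left column.\<close>

definition rect :: "nat \<Rightarrow> nat \<Rightarrow> nat \<Rightarrow> (nat \<times> nat) set" where
  "rect k a j = {a..<a + k} \<times> {j, Suc j}"

text \<open>Letters are indexed from 0 and columns from 1, hence the shift \<open>Suc i\<close>.\<close>

definition word_rects :: "nat \<Rightarrow> enat list \<Rightarrow> (nat \<times> nat) set set" where
  "word_rects k w = {rect k a (Suc i) | i a. i < length w \<and> w ! i = enat a}"

definition tiling_of_word :: "nat \<Rightarrow> nat \<Rightarrow> enat list \<Rightarrow> (nat \<times> nat) set set" where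
  "tiling_of_word k d w = word_rects k w \<union>
    (\<lambda>c. {c}) ` (board (k + d - 1) (length w) - \<Union> (word_rects k w))"

text \<open>The \<open>THE\<close> is meaningful once at most one rectangle of \<open>T\<close>
  starts in each column; \<open>tilings_rect_unique\<close> provides this for
  \<open>d \<le> k\<close>.\<close>

definition word_of_tiling :: "nat \<Rightarrow> nat \<Rightarrow> (nat \<times> nat) set set \<Rightarrow> enat list" where
  "word_of_tiling k n T =
    map (\<lambda>i. if \<exists>a. rect k a (Suc i) \<in> T then enat (THE a. rect k a (Suc i) \<in> T) else \<infinity>) [0..<n]"

section \<open>Position of a big rectangle on the board\<close>

lemma big_rectangle_iff: "big_rectangle k R \<longleftrightarrow> (\<exists>a j. R = rect k a j)"
  by (simp add: big_rectangle_def rect_def)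

text \<open>For \<open>k \<ge> 1\<close> each rectangle contains its top left cell. If the sets
  agree, each of these cells lies in the other rectangle, so the coordinates bound each other in
  both directions.\<close>

lemma rect_inject:
  assumes "k \<ge> 1"
  shows "rect k a j = rect k b l \<longleftrightarrow> a = b \<and> j = l"
proof
  assume eq: "rect k a j = rect k b l"
  have "(a, j) \<in> rect k a j" "(a, Suc j) \<in> rect k a j"
    "(b, l) \<in> rect k b l" "(b, Suc l) \<in> rect k b l"
    using assms by (auto simp: rect_def)
  then have "(a, j) \<in> rect k b l" "(a, Suc j) \<in> rect k b l"
    "(b, l) \<in> rect k a j" "(b, Suc l) \<in> rect k a j"
    unfolding eq by auto
  then show "a = b \<and> j = l" by (auto simp: rect_def)
qed simp

text \<open>The two columns keep even a rectangle with \<open>k = 1\<close> apart from a unit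
  square.\<close>

lemma rect_neq_singleton:
  assumes "k \<ge> 1"
  shows "rect k a j \<noteq> {c}"
proof
  assume "rect k a j = {c}"
  moreover have "(a, j) \<in> rect k a j" "(a, Suc j) \<in> rect k a j"
    using assms by (auto simp: rect_def)
  ultimately show False by auto
qed

lemma rect_subset_board_iff:
  assumes "k \<ge> 1" "1 \<le> d"
  shows "rect k a j \<subseteq> board (k + d - 1) n \<longleftrightarrow> 1 \<le> a \<and> a \<le> d \<and> 1 \<le> j \<and> j < n"
proof
  assume sub: "rect k a j \<subseteq> board (k + d - 1) n"
  \<comment> \<open>Two opposite corners give all the bounds: the bottom row
    \<open>a + k - 1\<close> is at most \<open>k + d - 1\<close> exactly when
    \<open>a \<le> d\<close>.\<close>
  have "(a, j) \<in> rect k a j" "(a + k - 1, Suc j) \<in> rect k a j"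
    using assms by (auto simp: rect_def)
  with sub have "(a, j) \<in> board (k + d - 1) n" "(a + k - 1, Suc j) \<in> board (k + d - 1) n"
    by auto
  then show "1 \<le> a \<and> a \<le> d \<and> 1 \<le> j \<and> j < n"
    using assms unfolding board_def by auto
qed (use assms in \<open>auto simp: rect_def board_def\<close>)

lemma tilings_rect_bounds:
  assumes "T \<in> tilings k d n" "k \<ge> 1" "1 \<le> d" "rect k a j \<in> T"
  shows "1 \<le> a" "a \<le> d" "1 \<le> j" "j < n"
proof -
  have "rect k a j \<subseteq> board (k + d - 1) n"
    using assms by (auto simp: tilings_def partition_on_def)
  then show "1 \<le> a" "a \<le> d" "1 \<le> j" "j < n"
    using rect_subset_board_iff[OF assms(2,3)] by auto
qed

text \<open>Both rectangles contain the cell in row \<open>k\<close> and column \<open>l\<close>.\<close>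

lemma tilings_rect_unique:
  assumes T: "T \<in> tilings k d n" and k: "k \<ge> 1" and d: "1 \<le> d" "d \<le> k"
    and R: "rect k a j \<in> T" "rect k b l \<in> T" and l: "l = j \<or> l = Suc j"
  shows "a = b" "j = l"
proof -
  have "(k, l) \<in> rect k a j \<inter> rect k b l"
    using tilings_rect_bounds[OF T k d(1) R(1)] tilings_rect_bounds[OF T k d(1) R(2)] d l
    by (auto simp: rect_def)
  moreover have "disjoint T"
    using T by (simp add: tilings_def partition_on_def)
  ultimately have "rect k a j = rect k b l"
    using R by (metis disjointD empty_iff)
  then show "a = b" "j = l"
    using rect_inject[OF k] by auto
qed

section \<open>From tilings to words\<close>

lemma word_of_tiling_nth_eq_enat_iff:
  assumes T: "T \<in> tilings k d n" and k: "k \<ge> 1" and d: "1 \<le> d" "d \<le> k" and i: "i < n"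
  shows "word_of_tiling k n T ! i = enat a \<longleftrightarrow> rect k a (Suc i) \<in> T"
proof (cases "\<exists>b. rect k b (Suc i) \<in> T")
  case True
  then obtain b where b: "rect k b (Suc i) \<in> T" by blast
  then have uniq: "c = b" if "rect k c (Suc i) \<in> T" for c
    using tilings_rect_unique[OF T k d that b] by simp
  with b have "(THE a. rect k a (Suc i) \<in> T) = b" by (intro the_equality)
  with True i have "word_of_tiling k n T ! i = enat b" by (simp add: word_of_tiling_def)
  moreover have "rect k a (Suc i) \<in> T \<longleftrightarrow> a = b" using uniq b by blast
  ultimately show ?thesis by auto
qed (use i in \<open>auto simp: word_of_tiling_def\<close>)

lemma length_word_of_tiling [simp]: "length (word_of_tiling k n T) = n"
  by (simp add: word_of_tiling_def)

lemma word_of_tiling_in_tiling_words: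
  assumes T: "T \<in> tilings k d n" and k: "k \<ge> 1" and d: "1 \<le> d" "d \<le> k"
  shows "word_of_tiling k n T \<in> tiling_words k d n"
proof -
  let ?w = "word_of_tiling k n T"
  note nth = word_of_tiling_nth_eq_enat_iff[OF T k d]
  have "x \<in> insert \<infinity> (enat ` {1..d})" if x: "x \<in> set ?w" for x
  proof -
    from x obtain i where i: "i < n" "?w ! i = x"
      by (auto simp: in_set_conv_nth)
    then show ?thesis
      using nth[OF i(1)] tilings_rect_bounds[OF T k d(1)] by (cases x) auto
  qed
  moreover have "last ?w = \<infinity>" if "n \<ge> 1"
  proof (rule ccontr)
    assume "last ?w \<noteq> \<infinity>"
    moreover have "?w \<noteq> []"
      using that by (metis length_word_of_tiling length_0_conv not_one_le_zero)
    ultimately obtain a where "?w ! (n - 1) = enat a"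
      by (auto simp: last_conv_nth)
    \<comment> \<open>Letter \<open>n - 1\<close> belongs to column \<open>n\<close>, and a
      rectangle starting there would stick out of the board.\<close>
    then show False
      using nth[of "n - 1" a] that tilings_rect_bounds(4)[OF T k d(1), of a n] by simp
  qed
  moreover have "?w ! Suc i \<ge> ?w ! i + enat k" if i: "Suc i < n" "?w ! i \<noteq> \<infinity>" for i
  proof -
    from i obtain a where a: "rect k a (Suc i) \<in> T"
      using nth[of i] by auto
    \<comment> \<open>Rectangles starting in neighbouring columns would overlap in the column they
      share.\<close>
    have "?w ! Suc i = \<infinity>"
    proof (rule ccontr)
      assume "?w ! Suc i \<noteq> \<infinity>"
      then obtain b where "rect k b (Suc (Suc i)) \<in> T"
        using nth[OF i(1)] by auto
      then show False
        using tilings_rect_unique(2)[OF T k d a, of b "Suc (Suc i)"] by simp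
    qed
    then show ?thesis by simp
  qed
  ultimately show ?thesis
    unfolding tiling_words_def by auto
qed

lemma tiling_of_word_of_tiling:
  assumes T: "T \<in> tilings k d n" and k: "k \<ge> 1" and d: "1 \<le> d" "d \<le> k"
  shows "tiling_of_word k d (word_of_tiling k n T) = T"
proof -
  let ?B = "board (k + d - 1) n"
  from T have part: "\<Union>T = ?B" "disjoint T" "{} \<notin> T"
    and tile: "\<And>R. R \<in> T \<Longrightarrow> unit_square R \<or> big_rectangle k R"
    by (auto simp: tilings_def partition_on_def)
  have rects: "word_rects k (word_of_tiling k n T) = {R \<in> T. big_rectangle k R}" (is "?W = ?R")
  proof (intro Set.set_eqI iffI)
    fix R assume "R \<in> ?W"
    then show "R \<in> ?R"
      using word_of_tiling_nth_eq_enat_iff[OF T k d]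
      by (auto simp: word_rects_def big_rectangle_iff)
  next
    fix R assume "R \<in> ?R"
    then obtain a j where aj: "R = rect k a j" "rect k a j \<in> T"
      by (auto simp: big_rectangle_iff)
    obtain i where i: "j = Suc i" "i < n"
      using tilings_rect_bounds[OF T k d(1) aj(2)] by (cases j) auto
    then have "word_of_tiling k n T ! i = enat a"
      using word_of_tiling_nth_eq_enat_iff[OF T k d i(2), of a] aj by simp
    with aj i show "R \<in> ?W"
      unfolding word_rects_def length_word_of_tiling by blast
  qed
  \<comment> \<open>The big rectangles determine the rest: a cell outside them lies in a tile that
    can only be a unit square, and by disjointness no unit square of \<open>T\<close> lies inside a
    big rectangle of \<open>T\<close>.\<close>
  have "(\<lambda>c. {c}) ` (?B - \<Union>?R) = T - ?R"
  proof (intro Set.set_eqI iffI)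
    fix S assume "S \<in> (\<lambda>c. {c}) ` (?B - \<Union>?R)"
    then obtain c where c: "S = {c}" "c \<in> ?B" "c \<notin> \<Union>?R" by auto
    then obtain S' where S': "S' \<in> T" "c \<in> S'" using part(1) by auto
    with c(3) tile[of S'] have "S' = {c}" "S' \<notin> ?R" by (auto simp: unit_square_def)
    with S' c show "S \<in> T - ?R" by auto
  next
    fix S assume S: "S \<in> T - ?R"
    with tile have "unit_square S" by blast
    then obtain c where c: "S = {c}" by (auto simp: unit_square_def)
    have "c \<notin> S'" if S': "S' \<in> ?R" for S'
    proof -
      have "S \<inter> S' = {}" using S S' part(2) by (intro disjointD[of T]) auto
      then show ?thesis using c by simp
    qed
    moreover have "c \<in> ?B" using S c part(1) by auto
    ultimately show "S \<in> (\<lambda>c. {c}) ` (?B - \<Union>?R)" using c by auto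
  qed
  moreover have "?R \<union> (T - ?R) = T" by blast
  ultimately show ?thesis
    by (simp only: tiling_of_word_def rects length_word_of_tiling)
qed

section \<open>From words to tilings\<close>

lemma big_rectangle_in_tiling_of_word_iff:
  assumes "k \<ge> 1"
  shows "R \<in> tiling_of_word k d w \<and> big_rectangle k R \<longleftrightarrow> R \<in> word_rects k w"
proof -
  have "big_rectangle k R" if "R \<in> word_rects k w"
    using that by (auto simp: word_rects_def big_rectangle_iff)
  moreover have "\<not> big_rectangle k {c}" for c
    using rect_neq_singleton[OF assms] by (metis big_rectangle_iff)
  ultimately show ?thesis
    by (auto simp: tiling_of_word_def)
qed

lemma rect_in_tiling_of_word_iff:
  assumes "k \<ge> 1" "i < length w"
  shows "rect k a (Suc i) \<in> tiling_of_word k d w \<longleftrightarrow> w ! i = enat a"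
proof -
  have "rect k a (Suc i) \<in> tiling_of_word k d w \<longleftrightarrow> rect k a (Suc i) \<in> word_rects k w"
    using big_rectangle_in_tiling_of_word_iff[OF assms(1)] by (metis big_rectangle_iff)
  also have "\<dots> \<longleftrightarrow> w ! i = enat a"
    using assms by (auto simp: word_rects_def rect_inject)
  finally show ?thesis .
qed

lemma tiling_of_word_in_tilings:
  assumes w: "w \<in> tiling_words k d n" and k: "k \<ge> 1" and d: "1 \<le> d" "d \<le> k"
  shows "tiling_of_word k d w \<in> tilings k d n"
proof -
  let ?B = "board (k + d - 1) n" and ?W = "word_rects k w"
  have len: "length w = n" using w by (simp add: tiling_words_def)
  note letter = tiling_words_letter[OF w d(2)]
  have sub: "R \<subseteq> ?B \<and> R \<noteq> {}" if "R \<in> ?W" for R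
  proof -
    from that obtain i a where R: "R = rect k a (Suc i)" "i < n" "w ! i = enat a"
      by (auto simp: word_rects_def len)
    with letter[OF R(2,3)] show ?thesis
      using rect_subset_board_iff[OF k d(1)] k by (auto simp: rect_def)
  qed
  have disj: "R = S" if "R \<in> ?W" "S \<in> ?W" "c \<in> R" "c \<in> S" for R S c
  proof -
    from that obtain i a where R: "R = rect k a (Suc i)" "i < n" "w ! i = enat a"
      by (auto simp: word_rects_def len)
    from that obtain j b where S: "S = rect k b (Suc j)" "j < n" "w ! j = enat b"
      by (auto simp: word_rects_def len)
    \<comment> \<open>Rectangles are two columns wide, so a common cell puts their left columns at
      distance at most one. Distance one is excluded because a finite letter is followed by
      \<open>\<infinity>\<close>.\<close>
    from that R S have "i = j \<or> i = Suc j \<or> j = Suc i"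
      by (auto simp: rect_def)
    then have "i = j"
      using letter(4)[OF R(2,3)] letter(4)[OF S(2,3)] R(3) S(3) by auto
    with R S show ?thesis by simp
  qed
  have "partition_on ?B (tiling_of_word k d w)"
  proof (rule partition_onI)
    show "\<Union> (tiling_of_word k d w) = ?B"
      using sub by (auto simp: tiling_of_word_def len)
    show "{} \<notin> tiling_of_word k d w"
      using sub by (auto simp: tiling_of_word_def)
    show "disjnt p q" if "p \<in> tiling_of_word k d w" "q \<in> tiling_of_word k d w" "p \<noteq> q" for p q
      using that disj by (auto simp: tiling_of_word_def disjnt_iff)
  qed
  moreover have "unit_square R \<or> big_rectangle k R" if "R \<in> tiling_of_word k d w" for R
    using that big_rectangle_in_tiling_of_word_iff[OF k, of R d w]
    by (auto simp: tiling_of_word_def unit_square_def)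
  ultimately show ?thesis
    by (simp add: tilings_def)
qed

lemma word_of_tiling_of_word:
  assumes w: "w \<in> tiling_words k d n" and k: "k \<ge> 1" and d: "1 \<le> d" "d \<le> k"
  shows "word_of_tiling k n (tiling_of_word k d w) = w"
proof (rule nth_equalityI)
  show len: "length (word_of_tiling k n (tiling_of_word k d w)) = length w"
    using w by (simp add: tiling_words_def)
  fix i assume "i < length (word_of_tiling k n (tiling_of_word k d w))"
  with len have i: "i < n" "i < length w" by auto
  \<comment> \<open>An element of \<open>enat\<close> is determined by which finite values it
    equals, so the case \<open>\<infinity>\<close> needs no argument of its own.\<close>
  have "word_of_tiling k n (tiling_of_word k d w) ! i = enat a \<longleftrightarrow> w ! i = enat a" for a
    using word_of_tiling_nth_eq_enat_iff[OF tiling_of_word_in_tilings[OF w k d] k d i(1)]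
      rect_in_tiling_of_word_iff[OF k i(2)] by simp
  then show "word_of_tiling k n (tiling_of_word k d w) ! i = w ! i"
    by (metis not_infinity_eq)
qed

section \<open>The bijection preserves the statistic\<close>

lemma rectangle_count_tiling_of_word:
  assumes k: "k \<ge> 1"
  shows "rectangle_count k (tiling_of_word k d w) = bigtiles w"
proof -
  let ?I = "{i. i < length w \<and> w ! i \<noteq> \<infinity>}"
  have "{R \<in> tiling_of_word k d w. big_rectangle k R} = word_rects k w"
    using big_rectangle_in_tiling_of_word_iff[OF k] by blast
  \<comment> \<open>Rectangles are indexed by the positions of finite letters, where
    \<open>the_enat\<close> is meaningful. The left column recovers the position, so the indexing is
    injective.\<close>
  also have "\<dots> = (\<lambda>i. rect k (the_enat (w ! i)) (Suc i)) ` ?I"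
    by (force simp: word_rects_def)
  finally have "rectangle_count k (tiling_of_word k d w) = card \<dots>"
    by (simp add: rectangle_count_def)
  also have "\<dots> = card ?I"
    by (rule card_image) (auto simp: inj_on_def rect_inject[OF k])
  also have "\<dots> = bigtiles w"
    by (simp add: bigtiles_def length_filter_conv_card)
  finally show ?thesis .
qed

lemma tiling_poly_eq_sum_tilings:
  assumes "k \<ge> 1" "1 \<le> d" "d \<le> k"
  shows "tiling_poly k d n = (\<Sum>T\<in>tilings k d n. monom 1 (rectangle_count k T))"
  unfolding tiling_poly_def
  by (rule sum.reindex_bij_witness[where j = "tiling_of_word k d" and i = "word_of_tiling k n"])
     (use assms in \<open>simp_all add: word_of_tiling_of_word tiling_of_word_of_tiling
        tiling_of_word_in_tilings word_of_tiling_in_tiling_words rectangle_count_tiling_of_word\<close>)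

theorem theorem4p9:
  fixes k d :: nat
  assumes "k \<ge> 1" and "1 \<le> d" and "d \<le> k"
  shows "(\<forall>n. tiling_poly k d n = (\<Sum>T\<in>tilings k d n. monom 1 (rectangle_count k T))) \<and>
    Abs_fps (\<lambda>n. to_fract (tiling_poly k d n)) =
      1 / (1 - (fps_X + fps_const (to_fract (of_nat d * [:0, 1:])) * fps_X ^ 2)) \<and>
    tiling_poly k d 0 = 1 \<and> tiling_poly k d 1 = 1 \<and>
    (\<forall>n\<ge>2. tiling_poly k d n =
      tiling_poly k d (n - 1) + of_nat d * [:0, 1:] * tiling_poly k d (n - 2)) \<and>
    (\<forall>n. only_real_zeros (tiling_poly k d n))"
proof (intro conjI allI impI)
  note rec = tiling_poly_Suc_Suc[OF assms(3)]
  show "tiling_poly k d n = (\<Sum>T\<in>tilings k d n. monom 1 (rectangle_count k T))" for n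
    using assms by (rule tiling_poly_eq_sum_tilings)
  show "Abs_fps (\<lambda>n. to_fract (tiling_poly k d n)) =
      1 / (1 - (fps_X + fps_const (to_fract (of_nat d * [:0, 1:])) * fps_X ^ 2))"
  proof -
    \<comment> \<open>The coefficients pass to the fraction field of the polynomial ring because the
      series lemma is stated over a field. The factor 1 matches its parameter
      \<open>a\<close>.\<close>
    have "to_fract (tiling_poly k d (Suc (Suc n))) = 1 * to_fract (tiling_poly k d (Suc n)) +
        to_fract (of_nat d * [:0, 1:]) * to_fract (tiling_poly k d n)" for n
      by (simp only: rec to_fract_add to_fract_mult mult_1)
    from fps_linear_recurrence_2[where p = "\<lambda>n. to_fract (tiling_poly k d n)", OF _ _ this] show ?thesis
      by (simp only: tiling_poly_0 tiling_poly_1 to_fract_1 fps_const_1_eq_1 mult_1)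
  qed
  show "tiling_poly k d 0 = 1" "tiling_poly k d 1 = 1"
    by (rule tiling_poly_0 tiling_poly_1)+
  show "tiling_poly k d n =
      tiling_poly k d (n - 1) + of_nat d * [:0, 1:] * tiling_poly k d (n - 2)" if "n \<ge> 2" for n
    using rec[of "n - 2"] that by (simp add: numeral_2_eq_2 Suc_diff_Suc)
  show "only_real_zeros (tiling_poly k d n)" for n
    using tiling_poly_0 tiling_poly_1 rec assms(2)
    by (intro only_real_zeros_linear_recurrence[where c = d]) auto
qed

end
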